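(* If $n$ is a positive integer and $p$ is an integer, then $$\sum_{k=1}^n(-1)^{(p-1)(n-k)}\frac{k}{n+k}\binom{n+k}{n-k}L_p^{2k-1}=\frac{F_{2np}}{2F_p}\qquad(p\ne0),$$ $$\sum_{k=1}^n(-1)^{p(n-k)}\frac{k}{n+k}\binom{n+k}{n-k}5^{k-1}F_p^{2k-1}=\frac{F_{2np}}{2L_p}.$$
   Context: $F_n$ and $L_n$ ($n\in\mathbb{Z}$) are the Fibonacci and Lucas numbers: $F_0=0$, $F_1=1$, $F_n=F_{n-1}+F_{n-2}$; $L_0=2$, $L_1=1$, $L_n=L_{n-1}+L_{n-2}$, extended to negative indices by $F_{-n}=(-1)^{n-1}F_n$, $L_{-n}=(-1)^nL_n$. *)

theory Defs
  imports Complex_Main "HOL-Number_Theory.Fib"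
begin

fun lucas :: "nat \<Rightarrow> nat" where
  "lucas 0 = 2"
| "lucas (Suc 0) = 1"
| "lucas (Suc (Suc n)) = lucas (Suc n) + lucas n"

definition fib_int :: "int \<Rightarrow> int" where
  "fib_int m = (if 0 \<le> m then int (fib (nat m))
                else (- 1) ^ (nat (- m) - 1) * int (fib (nat (- m))))"

definition lucas_int :: "int \<Rightarrow> int" where
  "lucas_int m = (if 0 \<le> m then int (lucas (nat m))
                  else (- 1) ^ nat (- m) * int (lucas (nat (- m))))"

lemma fib_int_of_nat [simp]: "fib_int (int n) = int (fib n)"
  by (simp add: fib_int_def)

lemma lucas_int_of_nat [simp]: "lucas_int (int n) = int (lucas n)"
  by (simp add: lucas_int_def)

lemma fib_int_minus: "fib_int (- int n) = (- 1) ^ (n - 1) * fib_int (int n)" if "n > 0"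
  using that by (simp add: fib_int_def)

lemma lucas_int_minus: "lucas_int (- int n) = (- 1) ^ n * lucas_int (int n)"
  by (cases "n = 0") (simp_all add: lucas_int_def)

lemma fib_int_rec: "fib_int m = fib_int (m - 1) + fib_int (m - 2)"
proof -
  consider n where "m = int (Suc (Suc n))" | "m = 1" | n where "m = - int n"
    by (cases m rule: int_cases2; metis One_nat_def not0_implies_Suc of_nat_0 of_nat_1 minus_zero)
  then show ?thesis
  proof cases
    case 1
    have "fib_int (m - 1) = int (fib (Suc n))" "fib_int (m - 2) = int (fib n)"
      using 1 fib_int_of_nat[of "Suc n"] fib_int_of_nat[of n] by (simp_all add: algebra_simps)
    then show ?thesis
      using fib_int_of_nat[of "Suc (Suc n)"] by (simp add: 1 del: of_nat_Suc)
  next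
    case 2
    then show ?thesis by (simp add: fib_int_def)
  next
    case (3 n)
    have e: "m - 1 = - int (Suc n)" "m - 2 = - int (Suc (Suc n))" using 3 by simp_all
    show ?thesis
      unfolding e fib_int_minus[OF zero_less_Suc] fib_int_of_nat
      by (cases n) (simp_all add: 3 fib_int_of_nat[of 0, simplified] fib_int_minus algebra_simps del: of_nat_Suc)
  qed
qed

lemma lucas_int_rec: "lucas_int m = lucas_int (m - 1) + lucas_int (m - 2)"
proof -
  consider n where "m = int (Suc (Suc n))" | "m = 1" | n where "m = - int n"
    by (cases m rule: int_cases2; metis One_nat_def not0_implies_Suc of_nat_0 of_nat_1 minus_zero)
  then show ?thesis
  proof cases
    case 1
    have "lucas_int (m - 1) = int (lucas (Suc n))" "lucas_int (m - 2) = int (lucas n)"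
      using 1 lucas_int_of_nat[of "Suc n"] lucas_int_of_nat[of n] by (simp_all add: algebra_simps)
    then show ?thesis
      using lucas_int_of_nat[of "Suc (Suc n)"] by (simp add: 1 del: of_nat_Suc)
  next
    case 2
    then show ?thesis by (simp add: lucas_int_def)
  next
    case (3 n)
    have e: "m - 1 = - int (Suc n)" "m - 2 = - int (Suc (Suc n))" using 3 by simp_all
    show ?thesis
      unfolding e lucas_int_minus lucas_int_of_nat
      by (simp add: 3 lucas_int_minus algebra_simps del: of_nat_Suc)
  qed
qed

end

theory Submission
  imports Defs
begin

text \<open>
  Write \<open>a = \<phi>\<^sup>p\<close> and \<open>b = \<psi>\<^sup>p\<close> for the roots \<open>\<phi>, \<psi>\<close> of \<open>x\<^sup>2 = x + 1\<close>, so that \<open>a b = (-1)\<^sup>p\<close>,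
  \<open>L\<^sub>p = a + b\<close> and \<open>\<surd>5 F\<^sub>p = a - b\<close>. As \<open>2k / (n + k) \<cdot> binom(n + k, n - k) = binom(n + k - 1, 2k - 1)\<close>,
  both sums are values of the polynomial
  \<open>V\<^sub>n(s, q) = \<Sum>k<n. binom(n + k, 2k + 1) q\<^bsup>n-1-k\<^esup> s\<^bsup>2k+1\<^esup>\<close>, up to a constant factor.
  Pascal's rule gives a first-order recursion for \<open>V\<^sub>n\<close> and the companion polynomial
  \<open>U\<^sub>n\<close>, which yields \<open>(a - b) V\<^sub>n(a + b, -a b) = a\<^bsup>2n\<^esup> - b\<^bsup>2n\<^esup>\<close>. The first identity is this
  formula at \<open>(a, b)\<close>, the second one at \<open>(a, -b)\<close>.
\<close>

section \<open>Binomial polynomials and their closed form\<close>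

definition odd_binomial_poly :: "nat \<Rightarrow> 'a::comm_ring_1 \<Rightarrow> 'a \<Rightarrow> 'a" where
  "odd_binomial_poly n s q =
     (\<Sum>k<n. of_nat ((n + k) choose (2 * k + 1)) * q ^ (n - 1 - k) * s ^ (2 * k + 1))"

text \<open>With \<open>u 0 = 0\<close>, \<open>u 1 = 1\<close> and
  \<open>u (m + 2) = s * u (m + 1) + q * u m\<close>, a Lucas sequence,
  \<open>odd_binomial_poly n s q\<close> is \<open>u (2 * n)\<close> and this is
  \<open>u (2 * n + 1)\<close>. The next two lemmas are that recurrence at even and odd
  indices.\<close>

definition even_binomial_poly :: "nat \<Rightarrow> 'a::comm_ring_1 \<Rightarrow> 'a \<Rightarrow> 'a" where
  "even_binomial_poly n s q =
     (\<Sum>k\<le>n. of_nat ((n + k) choose (2 * k)) * q ^ (n - k) * s ^ (2 * k))"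

lemma odd_binomial_poly_Suc:
  "odd_binomial_poly (Suc n) s q = s * even_binomial_poly n s q + q * odd_binomial_poly n s q"
proof -
  have "q * odd_binomial_poly n s q =
      (\<Sum>k<n. of_nat ((n + k) choose (2 * k + 1)) * q ^ (n - k) * s ^ (2 * k + 1))"
    unfolding odd_binomial_poly_def sum_distrib_left
  proof (rule sum.cong[OF refl])
    fix k assume "k \<in> {..<n}"
    then have "q ^ (n - k) = q * q ^ (n - 1 - k)"
      by (simp flip: power_Suc add: Suc_diff_Suc)
    then show "q * (of_nat ((n + k) choose (2 * k + 1)) * q ^ (n - 1 - k) * s ^ (2 * k + 1)) =
        of_nat ((n + k) choose (2 * k + 1)) * q ^ (n - k) * s ^ (2 * k + 1)"
      by (simp only: mult_ac)
  qed
  \<comment> \<open>The added term \<open>k = n\<close> vanishes, since its coefficient is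
    \<open>(2 * n) choose (2 * n + 1)\<close>.\<close>
  also have "\<dots> = (\<Sum>k\<le>n. of_nat ((n + k) choose (2 * k + 1)) * q ^ (n - k) * s ^ (2 * k + 1))"
    by (simp add: binomial_eq_0 flip: lessThan_Suc_atMost)
  \<comment> \<open>All sums now have the same range and monomials; Pascal's rule compares the
    coefficients.\<close>
  finally show ?thesis
    by (simp add: odd_binomial_poly_def even_binomial_poly_def lessThan_Suc_atMost
        sum_distrib_left algebra_simps flip: sum.distrib)
qed

lemma even_binomial_poly_Suc:
  "even_binomial_poly (Suc n) s q = s * odd_binomial_poly (Suc n) s q + q * even_binomial_poly n s q"
proof -
  \<comment> \<open>The monomial common to all three sums once the index is shifted by
    \<open>k = Suc j\<close>. The term \<open>k = 0\<close> is \<open>q ^ Suc n\<close>, which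
    occurs on the right only in \<open>q * even_binomial_poly n s q\<close>.\<close>
  define c :: "nat \<Rightarrow> 'a" where "c j = q ^ (n - j) * s ^ (2 * j + 2)" for j
  have "q * even_binomial_poly n s q =
      (\<Sum>k\<le>n. of_nat ((n + k) choose (2 * k)) * q ^ (Suc n - k) * s ^ (2 * k))"
    by (auto simp: even_binomial_poly_def sum_distrib_left Suc_diff_le mult_ac intro!: sum.cong)
  also have "\<dots> = (\<Sum>k\<le>Suc n. of_nat ((n + k) choose (2 * k)) * q ^ (Suc n - k) * s ^ (2 * k))"
    by (simp add: binomial_eq_0 del: binomial_Suc_Suc)
  also have "\<dots> = q ^ Suc n + (\<Sum>j\<le>n. of_nat ((n + Suc j) choose (2 * j + 2)) * c j)"
    by (subst sum.atMost_Suc_shift) (simp add: c_def mult_ac)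
  finally have even: "q * even_binomial_poly n s q =
      q ^ Suc n + (\<Sum>j\<le>n. of_nat ((n + Suc j) choose (2 * j + 2)) * c j)" .
  have odd: "s * odd_binomial_poly (Suc n) s q =
      (\<Sum>j\<le>n. of_nat ((n + Suc j) choose (2 * j + 1)) * c j)"
    by (simp add: odd_binomial_poly_def c_def lessThan_Suc_atMost sum_distrib_left mult_ac)
  have pascal: "(Suc n + Suc j) choose (2 * j + 2) =
      ((n + Suc j) choose (2 * j + 1)) + ((n + Suc j) choose (2 * j + 2))" for j
    by (metis One_nat_def Suc_1 add_Suc add_Suc_right add_Suc_shift add_0_right binomial_Suc_Suc)
  have "even_binomial_poly (Suc n) s q =
      q ^ Suc n + (\<Sum>j\<le>n. of_nat ((Suc n + Suc j) choose (2 * j + 2)) * c j)"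
    unfolding even_binomial_poly_def
    by (subst sum.atMost_Suc_shift) (simp add: c_def mult_ac del: binomial_Suc_Suc)
  also have "\<dots> = s * odd_binomial_poly (Suc n) s q + q * even_binomial_poly n s q"
    unfolding even odd
    by (simp only: pascal of_nat_add distrib_right sum.distrib add.left_commute)
  finally show ?thesis .
qed

text \<open>The differences \<open>a ^ m - b ^ m\<close> obey the same recurrence with
  \<open>s = a + b\<close> and \<open>q = - (a * b)\<close>. The parities feed each other, hence the
  joint induction; keeping the factor \<open>a - b\<close> avoids division.\<close>

lemma binomial_poly_closed_form:
  fixes a b :: "'a::comm_ring_1"
  shows "(a - b) * odd_binomial_poly n (a + b) (- (a * b)) = a ^ (2 * n) - b ^ (2 * n)"
    and "(a - b) * even_binomial_poly n (a + b) (- (a * b)) = a ^ (2 * n + 1) - b ^ (2 * n + 1)"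
proof (induction n)
  case 0
  show "(a - b) * odd_binomial_poly 0 (a + b) (- (a * b)) = a ^ (2 * 0) - b ^ (2 * 0)"
    by (simp add: odd_binomial_poly_def)
  show "(a - b) * even_binomial_poly 0 (a + b) (- (a * b)) = a ^ (2 * 0 + 1) - b ^ (2 * 0 + 1)"
    by (simp add: even_binomial_poly_def)
next
  case (Suc n)
  let ?V = "\<lambda>n. odd_binomial_poly n (a + b) (- (a * b))"
  let ?U = "\<lambda>n. even_binomial_poly n (a + b) (- (a * b))"
  have "(a - b) * ?V (Suc n) = (a + b) * ((a - b) * ?U n) + - (a * b) * ((a - b) * ?V n)"
    unfolding odd_binomial_poly_Suc by (simp only: distrib_left mult_ac)
  also have "\<dots> = a ^ (2 * Suc n) - b ^ (2 * Suc n)"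
    unfolding Suc.IH by (simp add: algebra_simps)
  finally show V: "(a - b) * ?V (Suc n) = a ^ (2 * Suc n) - b ^ (2 * Suc n)" .
  have "(a - b) * ?U (Suc n) = (a + b) * ((a - b) * ?V (Suc n)) + - (a * b) * ((a - b) * ?U n)"
    unfolding even_binomial_poly_Suc[of n] by (simp only: distrib_left mult_ac)
  also have "\<dots> = a ^ (2 * Suc n + 1) - b ^ (2 * Suc n + 1)"
    unfolding Suc.IH V by (simp add: algebra_simps)
  finally show "(a - b) * ?U (Suc n) = a ^ (2 * Suc n + 1) - b ^ (2 * Suc n + 1)" .
qed

section \<open>From the given summands to the odd binomial polynomial\<close>

lemma binomial_diff_eq_odd_binomial:
  assumes "0 < k" "k \<le> n"
  shows "real k / real (n + k) * real ((n + k) choose (n - k)) =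
    real ((n + k - 1) choose (2 * k - 1)) / 2"
proof -
  \<comment> \<open>Absorption: \<open>j * (m choose j) = m * ((m - 1) choose (j - 1))\<close> at
    \<open>j = 2 * k\<close>, \<open>m = n + k\<close>.\<close>
  have "2 * k * ((n + k) choose (2 * k)) = (n + k) * ((n + k - 1) choose (2 * k - 1))"
    using times_binomial_minus1_eq[of "2 * k" "n + k"] assms by simp
  moreover have "(n + k) choose (n - k) = (n + k) choose (2 * k)"
    using assms binomial_symmetric[of "n - k" "n + k"] by (simp add: mult_2)
  ultimately have "real (2 * k) * real ((n + k) choose (n - k)) =
      real (n + k) * real ((n + k - 1) choose (2 * k - 1))"
    by (metis of_nat_mult)
  then show ?thesis
    using assms by (simp add: field_simps)
qed

lemma sum_eq_odd_binomial_poly: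
  fixes q s :: real
  shows "(\<Sum>k=1..n. q ^ (n - k) * (real k / real (n + k)) * real ((n + k) choose (n - k)) *
      s ^ (2 * k - 1)) = odd_binomial_poly n s q / 2"
proof -
  have "(\<Sum>k=1..n. q ^ (n - k) * (real k / real (n + k)) * real ((n + k) choose (n - k)) *
      s ^ (2 * k - 1)) =
    (\<Sum>k=1..n. q ^ (n - k) * (real ((n + k - 1) choose (2 * k - 1)) / 2) * s ^ (2 * k - 1))"
  proof (rule sum.cong[OF refl])
    fix k assume "k \<in> {1..n}"
    then show "q ^ (n - k) * (real k / real (n + k)) * real ((n + k) choose (n - k)) *
        s ^ (2 * k - 1) =
      q ^ (n - k) * (real ((n + k - 1) choose (2 * k - 1)) / 2) * s ^ (2 * k - 1)"
      using binomial_diff_eq_odd_binomial[of k n]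
      by (simp only: mult.assoc[of "q ^ (n - k)"] atLeastAtMost_iff One_nat_def Suc_le_eq)
  qed
  \<comment> \<open>Replacing \<open>k\<close> by \<open>Suc k\<close> lets the range start at
    0.\<close>
  also have "\<dots> = odd_binomial_poly n s q / 2"
    unfolding odd_binomial_poly_def sum_divide_distrib One_nat_def sum.atLeast1_atMost_eq
    by (rule sum.cong[OF refl]) (simp add: mult_ac)
  finally show ?thesis .
qed

section \<open>Binet formulas at integer indices\<close>

definition golden :: real where "golden = (1 + sqrt 5) / 2"
definition golden_conj :: real where "golden_conj = (1 - sqrt 5) / 2"

lemma golden_mult_golden_conj: "golden * golden_conj = - 1"
  by (simp add: golden_def golden_conj_def algebra_simps)

lemma golden_diff: "golden - golden_conj = sqrt 5"
  by (simp add: golden_def golden_conj_def field_simps)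

lemma golden_power_Suc_Suc:
  "golden ^ Suc (Suc n) = golden ^ Suc n + golden ^ n"
  "golden_conj ^ Suc (Suc n) = golden_conj ^ Suc n + golden_conj ^ n"
proof -
  have "golden\<^sup>2 = golden + 1" "golden_conj\<^sup>2 = golden_conj + 1"
    by (simp_all add: golden_def golden_conj_def power2_eq_square field_simps)
  then show "golden ^ Suc (Suc n) = golden ^ Suc n + golden ^ n"
    "golden_conj ^ Suc (Suc n) = golden_conj ^ Suc n + golden_conj ^ n"
    by (simp_all add: power2_eq_square algebra_simps flip: mult.assoc)
qed

lemma fib_golden: "sqrt 5 * real (fib n) = golden ^ n - golden_conj ^ n"
  by (induction n rule: fib.induct)
    (simp_all add: golden_diff golden_power_Suc_Suc distrib_left del: power_Suc)

lemma lucas_golden: "real (lucas n) = golden ^ n + golden_conj ^ n"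
proof (induction n rule: lucas.induct)
  case 2
  then show ?case by (simp add: golden_def golden_conj_def field_simps)
qed (simp_all add: golden_power_Suc_Suc del: power_Suc)

text \<open>As the product of the roots is -1, the inverse of each is the negative of the
  other.\<close>

lemma golden_powi_minus:
  "golden powi (- int n) = (- 1) ^ n * golden_conj ^ n"
  "golden_conj powi (- int n) = (- 1) ^ n * golden ^ n"
proof -
  have "inverse golden = - golden_conj" "inverse golden_conj = - golden"
    using golden_mult_golden_conj by (auto intro!: inverse_unique simp: mult.commute)
  then show "golden powi (- int n) = (- 1) ^ n * golden_conj ^ n"
    "golden_conj powi (- int n) = (- 1) ^ n * golden ^ n"
    by (simp_all add: power_int_minus power_minus[of golden] power_minus[of golden_conj]
        flip: power_inverse)
qed

lemma fib_int_golden: "sqrt 5 * real_of_int (fib_int p) = golden powi p - golden_conj powi p"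
proof (cases p rule: int_cases2)
  case (nonneg n)
  then show ?thesis by (simp add: fib_golden)
next
  case (nonpos n)
  show ?thesis
  proof (cases n)
    case 0
    then show ?thesis by (simp add: nonpos fib_int_def)
  next
    case (Suc m)
    have "sqrt 5 * real_of_int (fib_int p) = (- 1) ^ m * (sqrt 5 * real (fib n))"
      using fib_int_minus[of n] by (simp add: nonpos Suc del: of_nat_Suc fib.simps)
    \<comment> \<open>Here \<open>n = Suc m\<close>, so the sign change from
      \<open>(- 1) ^ m\<close> to \<open>(- 1) ^ n\<close> reverses the difference.\<close>
    also have "\<dots> = (- 1) ^ n * (golden_conj ^ n - golden ^ n)"
      unfolding fib_golden by (simp add: Suc algebra_simps)
    finally show ?thesis
      unfolding nonpos golden_powi_minus by (simp add: algebra_simps)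
  qed
qed

lemma lucas_int_golden: "real_of_int (lucas_int p) = golden powi p + golden_conj powi p"
proof (cases p rule: int_cases2)
  case (nonneg n)
  then show ?thesis by (simp add: lucas_golden)
next
  case (nonpos n)
  then show ?thesis
    unfolding nonpos golden_powi_minus lucas_int_minus
    by (simp add: lucas_golden algebra_simps)
qed

lemma lucas_pos: "lucas n > 0"
  by (induction n rule: lucas.induct) auto

lemma lucas_int_nonzero: "lucas_int p \<noteq> 0"
  using lucas_pos by (simp add: lucas_int_def less_imp_neq[THEN not_sym])

lemma fib_int_nonzero: "p \<noteq> 0 \<Longrightarrow> fib_int p \<noteq> 0"
  by (simp add: fib_int_def fib_neq_0_nat)

lemma minus_one_powi: "(- 1 :: real) powi p = golden powi p * golden_conj powi p"
  by (simp add: golden_mult_golden_conj flip: power_int_mult_distrib)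

lemma fib_int_mult_golden:
  "sqrt 5 * real_of_int (fib_int (2 * int n * p)) =
    (golden powi p) ^ (2 * n) - (golden_conj powi p) ^ (2 * n)"
proof -
  have "x powi (2 * int n * p) = (x powi p) ^ (2 * n)" for x :: real
    using power_int_mult[of x p "int (2 * n)"]
    unfolding power_int_of_nat by (simp add: mult_ac)
  then show ?thesis by (simp only: fib_int_golden)
qed

section \<open>Evaluation of both sums at powers of the roots\<close>

theorem theorem15:
  fixes n :: nat and p :: int
  assumes "n > 0"
  shows "(p \<noteq> 0 \<longrightarrow>
           (\<Sum>k=1..n. (- 1) powi ((p - 1) * (int n - int k)) * (real k / real (n + k))
               * real ((n + k) choose (n - k)) * real_of_int (lucas_int p) ^ (2 * k - 1))
           = real_of_int (fib_int (2 * int n * p)) / (2 * real_of_int (fib_int p)))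
       \<and> (\<Sum>k=1..n. (- 1) powi (p * (int n - int k)) * (real k / real (n + k))
               * real ((n + k) choose (n - k)) * 5 ^ (k - 1) * real_of_int (fib_int p) ^ (2 * k - 1))
           = real_of_int (fib_int (2 * int n * p)) / (2 * real_of_int (lucas_int p))"
proof (intro conjI impI)
  define a b where "a = golden powi p" and "b = golden_conj powi p"
  have ab: "a * b = (- 1) powi p"
    by (simp add: a_def b_def minus_one_powi)
  have lucas: "real_of_int (lucas_int p) = a + b"
    by (simp add: a_def b_def lucas_int_golden)
  have fib: "sqrt 5 * real_of_int (fib_int p) = a - b"
    by (simp add: a_def b_def fib_int_golden)
  have fib_mult: "sqrt 5 * real_of_int (fib_int (2 * int n * p)) = a ^ (2 * n) - b ^ (2 * n)"
    by (simp add: a_def b_def fib_int_mult_golden)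
  have powi: "(- 1 :: real) powi (m * (int n - int k)) = ((- 1) powi m) ^ (n - k)"
    if "k \<in> {1..n}" for m k
    using that power_int_mult[of "- 1 :: real" m "int (n - k)"]
    unfolding power_int_of_nat by (simp add: of_nat_diff)
  {
    assume "p \<noteq> 0"
    \<comment> \<open>No Fibonacci number of nonzero index vanishes, so \<open>a - b\<close> may be
      cancelled below.\<close>
    then have "a - b \<noteq> 0" using fib fib_int_nonzero[of p] by auto
    have "(- 1 :: real) powi (p - 1) = - (a * b)"
      unfolding ab by (simp add: power_int_diff)
    then have "(\<Sum>k=1..n. (- 1) powi ((p - 1) * (int n - int k)) * (real k / real (n + k))
        * real ((n + k) choose (n - k)) * real_of_int (lucas_int p) ^ (2 * k - 1))
        = odd_binomial_poly n (a + b) (- (a * b)) / 2"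
      unfolding sum_eq_odd_binomial_poly[symmetric] lucas
      by (intro sum.cong[OF refl]) (simp only: powi)
    also have "\<dots> = (sqrt 5 * real_of_int (fib_int (2 * int n * p)))
        / (2 * (sqrt 5 * real_of_int (fib_int p)))"
      unfolding fib fib_mult binomial_poly_closed_form(1)[symmetric]
      unfolding mult.commute[of 2 "a - b"]
      by (rule mult_divide_mult_cancel_left[symmetric]) fact
    also have "\<dots> = real_of_int (fib_int (2 * int n * p)) / (2 * real_of_int (fib_int p))"
      by simp
    finally show "(\<Sum>k=1..n. (- 1) powi ((p - 1) * (int n - int k)) * (real k / real (n + k))
        * real ((n + k) choose (n - k)) * real_of_int (lucas_int p) ^ (2 * k - 1))
        = real_of_int (fib_int (2 * int n * p)) / (2 * real_of_int (fib_int p))" .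
  }
  have "a + b \<noteq> 0" using lucas lucas_int_nonzero[of p] by simp
  \<comment> \<open>The closed form at the pair \<open>a\<close>, \<open>- b\<close>: the sum is
    \<open>a - b\<close>, the negated product is \<open>a * b\<close>, the even powers are
    unchanged, and the factor becomes \<open>a + b\<close>.\<close>
  then have poly: "odd_binomial_poly n (a - b) (a * b) = (a ^ (2 * n) - b ^ (2 * n)) / (a + b)"
    using binomial_poly_closed_form(1)[of a "- b" n] by (simp add: eq_divide_eq mult.commute)
  \<comment> \<open>The odd power of \<open>a - b = sqrt 5 * F_p\<close> supplies
    \<open>5 ^ (k - 1)\<close> and one spare \<open>sqrt 5\<close>.\<close>
  have sqrt5: "5 ^ (k - 1) * real_of_int (fib_int p) ^ (2 * k - 1) = (a - b) ^ (2 * k - 1) / sqrt 5"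
    if "k \<in> {1..n}" for k
  proof -
    from that obtain j where "k = Suc j" by (cases k) auto
    then show ?thesis
      unfolding fib[symmetric] by (simp add: power_mult_distrib power_mult)
  qed
  have "(\<Sum>k=1..n. (- 1) powi (p * (int n - int k)) * (real k / real (n + k))
      * real ((n + k) choose (n - k)) * 5 ^ (k - 1) * real_of_int (fib_int p) ^ (2 * k - 1))
      = odd_binomial_poly n (a - b) (a * b) / 2 / sqrt 5"
    unfolding sum_eq_odd_binomial_poly[symmetric] sum_divide_distrib
    by (intro sum.cong[OF refl]) (simp only: powi ab mult.assoc sqrt5 times_divide_eq_right)
  also have "\<dots> = (a ^ (2 * n) - b ^ (2 * n)) / sqrt 5 / (2 * (a + b))"
    unfolding poly by simp
  also have "\<dots> = real_of_int (fib_int (2 * int n * p)) / (2 * real_of_int (lucas_int p))"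
    unfolding lucas fib_mult[symmetric] by simp
  finally show "(\<Sum>k=1..n. (- 1) powi (p * (int n - int k)) * (real k / real (n + k))
      * real ((n + k) choose (n - k)) * 5 ^ (k - 1) * real_of_int (fib_int p) ^ (2 * k - 1))
      = real_of_int (fib_int (2 * int n * p)) / (2 * real_of_int (lucas_int p))" .
qed

end
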